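(* There is a $\mu$-point in $\omega^\ast$ which is not a weak P-point of $\omega^\ast$.
   Context: $\omega^\ast=\beta\omega\setminus\omega=\mathrm{St}(\mathcal{P}(\omega)/\mathrm{fin})$ is the remainder of the Stone-Čech compactification of $\omega$, i.e. the space of non-principal ultrafilters on $\omega$. A measure on a topological space $X$ is a $\sigma$-additive Radon probability measure on the Borel sets of $X$. It is non-atomic if $\mu(\{x\})=0$ for every $x\in X$. The support of $\mu$ is $\mathrm{supp}(\mu)=\bigcap\{C\subseteq X: C \text{ closed},\ \mu(C)=1\}$. A point $x\in X$ is a $\mu$-point if it avoids non-atomic measures, i.e. $x\notin\mathrm{supp}(\nu)$ for every non-atomic measure $\nu$ on $X$. A point $p\in X$ is a weak P-point if $p\notin\overline{C}$ for every countable $C\subseteq X\setminus\{p\}$. *)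

theory Defs
  imports "HOL-Probability.Probability"
begin

definition is_ultrafilter :: "'a filter \<Rightarrow> bool" where
  "is_ultrafilter F \<longleftrightarrow>
     F \<noteq> bot \<and> (\<forall>P. eventually P F \<or> eventually (\<lambda>x. \<not> P x) F)"

definition stone_basic :: "nat set \<Rightarrow> nat filter set" where
  "stone_basic A = {F. is_ultrafilter F \<and> eventually (\<lambda>n. n \<in> A) F}"

definition beta_omega :: "nat filter topology" where
  "beta_omega = topology_generated_by (range stone_basic)"

text \<open>The point \<open>n\<close> of \<open>\<omega>\<close> is identified with the principal ultrafilter
  \<open>principal {n}\<close>.\<close>

definition omega_star :: "nat filter topology" where
  "omega_star = subtopology beta_omega (- range (\<lambda>n. principal {n}))"

lemma topspace_beta_omega: "topspace beta_omega = {F. is_ultrafilter F}"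
proof -
  have "stone_basic UNIV = {F. is_ultrafilter F}" "stone_basic A \<subseteq> {F. is_ultrafilter F}" for A
    by (auto simp: stone_basic_def)
  then have "\<Union>(range stone_basic) = {F. is_ultrafilter F}" by blast
  then show ?thesis
    by (simp add: beta_omega_def)
qed

lemma topspace_omega_star:
  "topspace omega_star = {F. is_ultrafilter F \<and> (\<forall>n. F \<noteq> principal {n})}"
  by (auto simp: omega_star_def topspace_subtopology topspace_beta_omega)

lemma Hausdorff_omega_star: "Hausdorff_space omega_star"
proof -
  have opn: "openin beta_omega (stone_basic A)" for A
    unfolding beta_omega_def by (rule topology_generated_by_Basis) simp
  have "\<exists>U V. openin beta_omega U \<and> openin beta_omega V \<and> F \<in> U \<and> G \<in> V \<and> disjnt U V"
    if F: "is_ultrafilter F" and G: "is_ultrafilter G" and "F \<noteq> G" for F G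
  proof -
    have "\<exists>P. eventually P F \<and> eventually (\<lambda>x. \<not> P x) G"
    proof (rule ccontr)
      assume no: "\<not> ?thesis"
      have "eventually P F \<longleftrightarrow> eventually P G" for P
      proof
        assume "eventually P F"
        with no G show "eventually P G" unfolding is_ultrafilter_def by blast
      next
        assume ev: "eventually P G"
        show "eventually P F"
        proof (rule ccontr)
          assume "\<not> eventually P F"
          with F have "eventually (\<lambda>x. \<not> P x) F" unfolding is_ultrafilter_def by blast
          moreover from ev have "eventually (\<lambda>x. \<not> \<not> P x) G" by simp
          ultimately show False using no by blast
        qed
      qed
      then have "F = G" by (simp add: filter_eq_iff)
      with \<open>F \<noteq> G\<close> show False ..
    qed
    then obtain P where P: "eventually P F" "eventually (\<lambda>x. \<not> P x) G" by blast
    have "disjnt (stone_basic {x. P x}) (stone_basic {x. \<not> P x})"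
    proof -
      have False if "is_ultrafilter H" "eventually P H" "eventually (\<lambda>x. \<not> P x) H" for H
      proof -
        have "eventually (\<lambda>x. False) H"
          using eventually_conj[OF that(2,3)] by simp
        then show False
          using that(1) by (simp add: is_ultrafilter_def)
      qed
      then show ?thesis
        by (auto simp: disjnt_def stone_basic_def)
    qed
    moreover have "F \<in> stone_basic {x. P x}" "G \<in> stone_basic {x. \<not> P x}"
      using F G P by (auto simp: stone_basic_def)
    ultimately show ?thesis using opn by blast
  qed
  then have "Hausdorff_space beta_omega"
    unfolding Hausdorff_space_def topspace_beta_omega by blast
  then show ?thesis
    unfolding omega_star_def by (rule Hausdorff_space_subtopology)
qed

text \<open>The condition \<open>K \<in> sets M\<close> is redundant in Hausdorff spaces, where compact sets are
  closed. There inner regularity on all Borel sets implies outer regularity, as the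
  measure is finite (take complements).\<close>

definition radon_probability :: "'a topology \<Rightarrow> 'a measure \<Rightarrow> bool" where
  "radon_probability X M \<longleftrightarrow>
     prob_space M \<and>
     space M = topspace X \<and>
     sets M = sigma_sets (topspace X) {U. openin X U} \<and>
     (\<forall>B\<in>sets M. emeasure M B =
        (SUP K\<in>{K. compactin X K \<and> K \<in> sets M \<and> K \<subseteq> B}. emeasure M K))"

text \<open>Meant for \<open>T1\<close> spaces: otherwise \<open>{x}\<close> need not be Borel, and \<open>measure\<close> is \<open>0\<close> on
  sets outside \<open>sets M\<close>.\<close>

definition non_atomic :: "'a topology \<Rightarrow> 'a measure \<Rightarrow> bool" where
  "non_atomic X M \<longleftrightarrow> (\<forall>x\<in>topspace X. measure M {x} = 0)"

definition measure_support :: "'a topology \<Rightarrow> 'a measure \<Rightarrow> 'a set" where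
  "measure_support X M = \<Inter>{C. closedin X C \<and> measure M C = 1}"

definition mu_point :: "'a topology \<Rightarrow> 'a \<Rightarrow> bool" where
  "mu_point X x \<longleftrightarrow> x \<in> topspace X \<and>
     (\<forall>M. radon_probability X M \<and> non_atomic X M \<longrightarrow> x \<notin> measure_support X M)"

definition weak_P_point :: "'a topology \<Rightarrow> 'a \<Rightarrow> bool" where
  "weak_P_point X p \<longleftrightarrow> p \<in> topspace X \<and>
     (\<forall>C. countable C \<and> C \<subseteq> topspace X - {p} \<longrightarrow> p \<notin> X closure_of C)"

end

theory Submission imports Defs begin

text \<open>Kunen's construction of an OK ultrafilter yields a non-principal \<open>p\<close> with the following
  property: for all \<open>U\<^sub>k \<in> p\<close> there are uncountably many \<open>V\<^sub>Y \<in> p\<close> such that any \<open>k\<close> of them meet inside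
  \<open>U\<^sub>k\<close> up to a finite error that depends only on the chosen indices \<open>Y\<close>. If a finitely additive
  measure takes arbitrarily small values \<open>m U\<^sub>k\<close> on \<open>p\<close>, then a double count shows that all but
  countably many \<open>V\<^sub>Y\<close> are null. So \<open>p\<close> is a \<open>\<mu>\<close>-point.

  The point wanted is the Fubini square \<open>q = p \<otimes> p\<close> on \<open>\<omega> \<times> \<omega>\<close>, a limit of the copies of \<open>p\<close> on the
  columns \<open>{n} \<times> \<omega>\<close>. If \<open>m\<close> comes from a non-atomic measure, each of these copies contains a null
  set \<open>{n} \<times> B\<^sub>n\<close>. The witnesses \<open>V\<close> for the first coordinate and for every column combine into
  uncountably many members of \<open>q\<close>. Their errors lie in finitely many of the sets \<open>{n} \<times> B\<^sub>n\<close>,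
  so they are null, and the same count produces a null member of \<open>q\<close>.\<close>

section \<open>Independent linked families\<close>

text \<open>Distinct sets differ at some \<open>d\<close> and are separated by every
  \<open>k > d\<close>; finitely many pairs have a common bound. Thus finite sets of indices are
  faithfully visible at all high levels \<open>k\<close>.\<close>

lemma eventually_inj_on_truncate:
  fixes b :: "nat set set"
  assumes "finite b"
  shows "eventually (\<lambda>k. inj_on (\<lambda>Y. Y \<inter> {..<k}) b) sequentially"
proof -
  have "eventually (\<lambda>k. Y \<inter> {..<k} = Z \<inter> {..<k} \<longrightarrow> Y = Z) sequentially" for Y Z :: "nat set"
  proof (cases "Y = Z")
    case False
    then obtain d where d: "d \<in> Y \<longleftrightarrow> d \<notin> Z" by blast
    have "Y \<inter> {..<k} \<noteq> Z \<inter> {..<k}" if "k \<ge> Suc d" for k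
    proof
      assume "Y \<inter> {..<k} = Z \<inter> {..<k}"
      then have "d \<in> Y \<inter> {..<k} \<longleftrightarrow> d \<in> Z \<inter> {..<k}" by simp
      with d that show False by auto
    qed
    then show ?thesis
      unfolding eventually_sequentially by blast
  qed simp
  then show ?thesis
    unfolding inj_on_def using assms by (intro eventually_ball_finite ballI) auto
qed

text \<open>Kunen's independent linked family, in the form found by Simon: the points are pairs
  \<open>(k, f)\<close> with \<open>f\<close> a map from the subsets of \<open>{..<k}\<close> to families of such subsets.\<close>

lemma ex_independent_linked_family:
  "\<exists>(A :: nat set \<Rightarrow> nat set \<Rightarrow> nat \<Rightarrow> nat set) (J :: nat set set \<Rightarrow> nat).
     (\<forall>X Y m n. m \<le> n \<longrightarrow> A X Y m \<subseteq> A X Y n) \<and>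
     (\<forall>X b n. finite b \<longrightarrow> n < card b \<longrightarrow> (\<Inter>Y\<in>b. A X Y n) \<subseteq> {..<J b}) \<and>
     (\<forall>C b. finite C \<longrightarrow> (\<forall>X\<in>C. finite (b X)) \<longrightarrow>
        infinite (\<Inter>X\<in>C. \<Inter>Y\<in>b X. A X Y (card (b X))))"
proof -
  define S :: "(nat \<times> (nat set \<Rightarrow> nat set set)) set"
    where "S = (SIGMA k:UNIV. Pow {..<k} \<rightarrow>\<^sub>E Pow (Pow {..<k}))"
  have fin: "finite (Pow {..<k} \<rightarrow>\<^sub>E Pow (Pow {..<k}))" for k :: nat
    by (intro finite_PiE) auto
  have "countable S"
    unfolding S_def by (intro countable_SIGMA countableI_type countable_finite[OF fin])
  have inS: "(k, \<lambda>Z\<in>Pow {..<k}. g Z \<inter> Pow {..<k}) \<in> S" for k g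
    by (auto simp: S_def)
  have "infinite S"
  proof
    assume "finite S"
    then have "finite (fst ` S)" by simp
    moreover have "fst ` S = UNIV"
      using inS by (force simp: image_iff)
    ultimately show False by simp
  qed
  define E where "E = from_nat_into S"
  have E: "bij_betw E UNIV S"
    unfolding E_def by (rule bij_betw_from_nat_into) fact+
  then have "inj E" and ES: "E j \<in> S" for j
    by (auto simp: bij_betw_def)
  \<comment> \<open>Each level carries finitely many points and \<open>E\<close> is injective, so
    bounding the level leaves finitely many \<open>j\<close>.\<close>
  have fib: "finite {j. fst (E j) < k}" for k
  proof -
    have "finite (SIGMA k:{..<k}. Pow {..<k} \<rightarrow>\<^sub>E Pow (Pow {..<k}))"
      using fin by (intro finite_SigmaI) auto
    then have "finite (E -` (SIGMA k:{..<k}. Pow {..<k} \<rightarrow>\<^sub>E Pow (Pow {..<k})))"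
      using \<open>inj E\<close> by (rule finite_vimageI)
    moreover have "{j. fst (E j) < k} \<subseteq> E -` (SIGMA k:{..<k}. Pow {..<k} \<rightarrow>\<^sub>E Pow (Pow {..<k}))"
    proof
      fix j assume "j \<in> {j. fst (E j) < k}"
      with ES[of j] show "j \<in> E -` (SIGMA k:{..<k}. Pow {..<k} \<rightarrow>\<^sub>E Pow (Pow {..<k}))"
        by (cases "E j") (auto simp: S_def)
    qed
    ultimately show ?thesis by (rule finite_subset[rotated])
  qed
  define tr :: "nat \<Rightarrow> nat set \<Rightarrow> nat set" where "tr k Y = Y \<inter> {..<k}" for k Y
  \<comment> \<open>The point \<open>E j = (k, f)\<close> offers, for the cut of \<open>X\<close> at
    \<open>k\<close>, a list of cuts. \<open>n\<close> caps the length of that list, so more than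
    \<open>n\<close> separated sets can never all be on it.\<close>
  define A where "A X Y n = {j. card (snd (E j) (tr (fst (E j)) X)) \<le> n \<and>
    tr (fst (E j)) Y \<in> snd (E j) (tr (fst (E j)) X)}" for X Y n
  have fin_val: "finite (snd (E j) (tr (fst (E j)) X))" for j X
  proof -
    have "snd (E j) \<in> Pow {..<fst (E j)} \<rightarrow>\<^sub>E Pow (Pow {..<fst (E j)})"
      using ES[of j] by (cases "E j") (auto simp: S_def)
    from PiE_mem[OF this, of "tr (fst (E j)) X"]
    have "snd (E j) (tr (fst (E j)) X) \<in> Pow (Pow {..<fst (E j)})"
      by (auto simp: tr_def)
    then show ?thesis by (meson PowD finite_Pow_iff finite_lessThan finite_subset)
  qed
  \<comment> \<open>The bound is chosen before \<open>X\<close> and \<open>n\<close>: it comes only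
    from the level that separates the members of \<open>b\<close>.\<close>
  have "\<exists>N. \<forall>X n. finite b \<longrightarrow> n < card b \<longrightarrow> (\<Inter>Y\<in>b. A X Y n) \<subseteq> {..<N}" for b
  proof (cases "finite b")
    case True
    then obtain k0 where k0: "inj_on (tr k) b" if "k \<ge> k0" for k
      using eventually_inj_on_truncate unfolding tr_def eventually_sequentially by blast
    obtain N where N: "{j. fst (E j) < k0} \<subseteq> {..<N}"
      using finite_nat_bounded[OF fib] by blast
    \<comment> \<open>At a level from \<open>k0\<close> on, the \<open>card b\<close> distinct cuts
      would all sit in a list of at most \<open>n < card b\<close> entries.\<close>
    have "fst (E j) < k0" if "n < card b" and j: "j \<in> (\<Inter>Y\<in>b. A X Y n)" for X n j
    proof (rule ccontr)
      assume "\<not> fst (E j) < k0"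
      then have "card b = card (tr (fst (E j)) ` b)"
        using k0 by (simp add: card_image)
      also have "\<dots> \<le> card (snd (E j) (tr (fst (E j)) X))"
        using j by (intro card_mono fin_val) (auto simp: A_def)
      also have "\<dots> \<le> n"
        using j \<open>n < card b\<close> by (cases "b = {}") (auto simp: A_def)
      finally show False using \<open>n < card b\<close> by simp
    qed
    then show ?thesis using N by (intro exI[of _ N]) blast
  qed auto
  then obtain J where J: "\<And>b X n. finite b \<Longrightarrow> n < card b \<Longrightarrow> (\<Inter>Y\<in>b. A X Y n) \<subseteq> {..<J b}"
    by metis
  have inf: "infinite (\<Inter>X\<in>C. \<Inter>Y\<in>b X. A X Y (card (b X)))"
    if C: "finite C" and b: "\<And>X. X \<in> C \<Longrightarrow> finite (b X)" for C b
  proof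
    let ?I = "\<Inter>X\<in>C. \<Inter>Y\<in>b X. A X Y (card (b X))"
    assume "finite ?I"
    obtain k0 where k0: "inj_on (tr k) C" if "k \<ge> k0" for k
      using eventually_inj_on_truncate[OF C] unfolding tr_def eventually_sequentially by blast
    have "k \<in> (fst \<circ> E) ` ?I" if k: "k \<ge> k0" for k
    proof -
      \<comment> \<open>At each level from \<open>k0\<close> on, the point whose list for the cut of
        \<open>X\<close> is the set of cuts of \<open>b X\<close> lies in the intersection.
        \<open>inv_into\<close> recovers \<open>X\<close> because the cuts of \<open>C\<close> are
        distinct. Levels are thus unbounded there.\<close>
      define f where "f = (\<lambda>Z\<in>Pow {..<k}. tr k ` b (inv_into C (tr k) Z) \<inter> Pow {..<k})"
      have "(k, f) \<in> S" unfolding f_def by (rule inS)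
      then obtain j where j: "E j = (k, f)"
        using E by (metis bij_betw_iff_bijections)
      have f: "f (tr k X) = tr k ` b X" if "X \<in> C" for X
      proof -
        have "tr k ` b X \<subseteq> Pow {..<k}" "tr k X \<in> Pow {..<k}"
          by (auto simp: tr_def)
        moreover have "inv_into C (tr k) (tr k X) = X"
          using k0[OF k] that by (rule inv_into_f_f)
        ultimately show ?thesis
          unfolding f_def by (simp add: Int_absorb2)
      qed
      \<comment> \<open>Cuts of \<open>b X\<close> may coincide, but this only shortens the list, so
        the cap \<open>card (b X)\<close> is respected.\<close>
      have "j \<in> A X Y (card (b X))" if "X \<in> C" "Y \<in> b X" for X Y
        using that b by (auto simp: A_def j f intro: card_image_le)
      then show ?thesis using j by (force simp: image_iff)
    qed
    then have "{k0..} \<subseteq> (fst \<circ> E) ` ?I" by auto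
    with \<open>finite ?I\<close> show False
      by (meson finite_imageI finite_subset infinite_Ici)
  qed
  have mono: "A X Y m \<subseteq> A X Y n" if "m \<le> n" for X Y m n
    using that by (auto simp: A_def)
  show ?thesis
  proof (intro exI conjI allI impI)
    show "A X Y m \<subseteq> A X Y n" if "m \<le> n" for X Y m n
      using that by (rule mono)
    show "(\<Inter>Y\<in>b. A X Y n) \<subseteq> {..<J b}" if "finite b" "n < card b" for X b n
      using that by (rule J)
    show "infinite (\<Inter>X\<in>C. \<Inter>Y\<in>b X. A X Y (card (b X)))"
      if "finite C" "\<forall>X\<in>C. finite (b X)" for C b
      using that by (intro inf) auto
  qed
qed

section \<open>OK ultrafilters\<close>

text \<open>\<open>K\<close> holds the rows already spent; the others stay in general position over
  \<open>G\<close>. The level \<open>card (b i)\<close> is the least one at which linkedness puts no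
  bound on the intersection.\<close>

definition independent_mod ::
    "('i \<Rightarrow> 'j \<Rightarrow> nat \<Rightarrow> 'a set) \<Rightarrow> 'a set set \<Rightarrow> 'i set \<Rightarrow> bool" where
  "independent_mod A G K \<longleftrightarrow>
     (\<forall>H C b. finite H \<and> H \<subseteq> G \<and> finite C \<and> C \<inter> K = {} \<and> (\<forall>i\<in>C. finite (b i)) \<longrightarrow>
        infinite (\<Inter>H \<inter> (\<Inter>i\<in>C. \<Inter>Y\<in>b i. A i Y (card (b i)))))"

lemma independent_modI:
  assumes "\<And>H C b. finite H \<Longrightarrow> H \<subseteq> G \<Longrightarrow> finite C \<Longrightarrow> C \<inter> K = {} \<Longrightarrow> (\<And>i. i \<in> C \<Longrightarrow> finite (b i)) \<Longrightarrow>
      infinite (\<Inter>H \<inter> (\<Inter>i\<in>C. \<Inter>Y\<in>b i. A i Y (card (b i))))"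
  shows "independent_mod A G K"
  using assms unfolding independent_mod_def by blast

lemma independent_modD:
  assumes "independent_mod A G K" "finite H" "H \<subseteq> G" "finite C" "C \<inter> K = {}"
    "\<And>i. i \<in> C \<Longrightarrow> finite (b i)"
  shows "infinite (\<Inter>H \<inter> (\<Inter>i\<in>C. \<Inter>Y\<in>b i. A i Y (card (b i))))"
  using assms unfolding independent_mod_def by blast

text \<open>Either the sequence \<open>U\<close> is excluded from the filter generated by \<open>G\<close> and the cofinite sets,
  or it is put into it together with witnesses \<open>V\<close> for being OK. Both cost only finitely many
  rows of the linked family.\<close>

definition settled ::
    "('j set \<Rightarrow> 'a set) \<Rightarrow> 'a set set \<Rightarrow> (nat \<Rightarrow> 'a set) \<Rightarrow> bool" where
  "settled B G U \<longleftrightarrow>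
     (\<exists>n H. finite H \<and> H \<subseteq> G \<and> finite (\<Inter>H \<inter> U n)) \<or>
     (range U \<subseteq> G \<and> (\<exists>V. range V \<subseteq> G \<and>
        (\<forall>b. finite b \<longrightarrow> b \<noteq> {} \<longrightarrow> (\<Inter>Y\<in>b. V Y) \<subseteq> U (card b) \<union> B b)))"

lemma settled_mono: "settled B G U \<Longrightarrow> G \<subseteq> G' \<Longrightarrow> settled B G' U"
  unfolding settled_def by (meson order_trans)

text \<open>If some condition on unspent rows together with finitely many members of
  \<open>G\<close> almost misses some \<open>U n\<close>, adding that condition excludes
  \<open>U\<close>. Otherwise every \<open>U n\<close> is compatible with all such conditions, and
  the fresh row \<open>i\<close> can be spent on building the witnesses.\<close>

lemma settle_step:
  fixes A :: "'i \<Rightarrow> 'j \<Rightarrow> nat \<Rightarrow> 'a set"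
  assumes mono: "\<And>i Y m n. m \<le> n \<Longrightarrow> A i Y m \<subseteq> A i Y n"
    and linked: "\<And>i b n. finite b \<Longrightarrow> n < card b \<Longrightarrow> (\<Inter>Y\<in>b. A i Y n) \<subseteq> B b"
    and indep: "independent_mod A G K" and i: "i \<notin> K" and "decseq U"
  shows "\<exists>G' K'. finite K' \<and> independent_mod A (G \<union> G') (K \<union> K') \<and> settled B (G \<union> G') U"
proof (cases "\<exists>H C b n. finite H \<and> H \<subseteq> G \<and> finite C \<and> C \<inter> K = {} \<and> (\<forall>i\<in>C. finite (b i)) \<and>
    finite (\<Inter>H \<inter> (\<Inter>i\<in>C. \<Inter>Y\<in>b i. A i Y (card (b i))) \<inter> U n)")
  case True
  then obtain H C b n where H: "finite H" "H \<subseteq> G" and C: "finite C" "C \<inter> K = {}"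
    and b: "\<forall>i\<in>C. finite (b i)"
    and fin: "finite (\<Inter>H \<inter> (\<Inter>i\<in>C. \<Inter>Y\<in>b i. A i Y (card (b i))) \<inter> U n)"
    by blast
  define D where "D = (\<Inter>i\<in>C. \<Inter>Y\<in>b i. A i Y (card (b i)))"
  have "independent_mod A (G \<union> {D}) (K \<union> C)"
  proof (rule independent_modI)
    fix H' and C' :: "'i set" and b' :: "'i \<Rightarrow> 'j set"
    assume *: "finite H'" "H' \<subseteq> G \<union> {D}" "finite C'" "C' \<inter> (K \<union> C) = {}"
      "\<And>i. i \<in> C' \<Longrightarrow> finite (b' i)"
    \<comment> \<open>Conditions on the disjoint row sets \<open>C\<close> and \<open>C'\<close>
      merge into a single condition on their union, from which \<open>D\<close> is
      recovered.\<close>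
    define b'' where "b'' i = (if i \<in> C then b i else b' i)" for i
    have "infinite (\<Inter>(H' - {D}) \<inter> (\<Inter>i\<in>C \<union> C'. \<Inter>Y\<in>b'' i. A i Y (card (b'' i))))"
      using * C b by (intro independent_modD[OF indep]) (auto simp: b''_def)
    moreover have "\<Inter>(H' - {D}) \<inter> (\<Inter>i\<in>C \<union> C'. \<Inter>Y\<in>b'' i. A i Y (card (b'' i))) \<subseteq>
      \<Inter>H' \<inter> (\<Inter>i\<in>C'. \<Inter>Y\<in>b' i. A i Y (card (b' i)))" (is "?L \<subseteq> ?R")
    proof
      fix x assume x: "x \<in> ?L"
      have row: "x \<in> A i Y (card (b'' i))" if "i \<in> C \<union> C'" "Y \<in> b'' i" for i Y
        using x that by blast
      have "x \<in> A i Y (card (b i))" if "i \<in> C" "Y \<in> b i" for i Y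
        using row[of i Y] that by (simp add: b''_def)
      then have "x \<in> D" unfolding D_def by blast
      moreover have "x \<in> A i Y (card (b' i))" if "i \<in> C'" "Y \<in> b' i" for i Y
      proof -
        have "i \<notin> C" using that *(4) by blast
        then have "b'' i = b' i" by (simp add: b''_def)
        then show ?thesis using row[of i Y] that by simp
      qed
      ultimately show "x \<in> ?R" using x by blast
    qed
    ultimately show "infinite (\<Inter>H' \<inter> (\<Inter>i\<in>C'. \<Inter>Y\<in>b' i. A i Y (card (b' i))))"
      using infinite_super by blast
  qed
  moreover have "settled B (G \<union> {D}) U"
    unfolding settled_def
  proof (intro disjI1 exI conjI)
    show "finite (insert D H)" "insert D H \<subseteq> G \<union> {D}" using H by auto
    show "finite (\<Inter>(insert D H) \<inter> U n)"
      using fin unfolding D_def by (auto elim!: rev_finite_subset)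
  qed
  ultimately show ?thesis using C by blast
next
  case False
  then have inf: "infinite (\<Inter>H \<inter> (\<Inter>i\<in>C. \<Inter>Y\<in>b i. A i Y (card (b i))) \<inter> U n)"
    if "finite H" "H \<subseteq> G" "finite C" "C \<inter> K = {}" "\<And>i. i \<in> C \<Longrightarrow> finite (b i)" for H C b n
    using that by blast
  \<comment> \<open>On the layer \<open>U n - U (Suc n)\<close> the set \<open>V Y\<close> follows
    \<open>A i Y n\<close>; points in every \<open>U n\<close> belong to every \<open>V Y\<close>.
    So a point outside \<open>U (card b)\<close> meets row \<open>i\<close> at a level below
    \<open>card b\<close>, where linkedness applies.\<close>
  define V where "V Y = {x \<in> U 0. \<forall>n. x \<in> U n - U (Suc n) \<longrightarrow> x \<in> A i Y n}" for Y
  have Vsub: "U n \<inter> A i Y m \<subseteq> V Y" if "m \<le> n" for n m Y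
  proof
    fix x assume x: "x \<in> U n \<inter> A i Y m"
    have "x \<in> A i Y k" if "x \<in> U k - U (Suc k)" for k
    proof -
      have "n \<le> k"
        using that x decseqD[OF \<open>decseq U\<close>, of "Suc k" n] by (meson Diff_iff IntE not_less_eq_eq subsetD)
      then show ?thesis using mono[of m k i Y] \<open>m \<le> n\<close> x by auto
    qed
    then show "x \<in> V Y"
      using x decseqD[OF \<open>decseq U\<close>, of 0 n] by (auto simp: V_def)
  qed
  have "independent_mod A (G \<union> (range U \<union> range V)) (K \<union> {i})"
  proof (rule independent_modI)
    fix H and C :: "'i set" and c :: "'i \<Rightarrow> 'j set"
    assume *: "finite H" "H \<subseteq> G \<union> (range U \<union> range V)" "finite C" "C \<inter> (K \<union> {i}) = {}"
      "\<And>i. i \<in> C \<Longrightarrow> finite (c i)"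
    have "finite (H \<inter> range U)" "finite (H \<inter> range V)" using * by auto
    then obtain N b where N: "finite N" "H \<inter> range U = U ` N" and b: "finite b" "H \<inter> range V = V ` b"
      by (meson finite_subset_image inf_le2)
    \<comment> \<open>One \<open>U n\<close> handles both kinds of new members: it lies in all
      \<open>U k\<close> with \<open>k\<close> in \<open>N\<close>, and
      \<open>card b \<le> n\<close> puts its points of \<open>A i Y (card b)\<close> into
      \<open>V Y\<close>.\<close>
    obtain n where n: "\<And>k. k \<in> N \<Longrightarrow> k \<le> n" "card b \<le> n"
      using N(1) by (metis finite_nat_set_iff_bounded_le max.coboundedI1 max.coboundedI2 order_refl)
    define c' where "c' = c(i := b)"
    have "infinite (\<Inter>(H \<inter> G) \<inter> (\<Inter>i\<in>insert i C. \<Inter>Y\<in>c' i. A i Y (card (c' i))) \<inter> U n)"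
      using * i b by (intro inf) (auto simp: c'_def)
    moreover have "\<Inter>(H \<inter> G) \<inter> (\<Inter>i\<in>insert i C. \<Inter>Y\<in>c' i. A i Y (card (c' i))) \<inter> U n \<subseteq>
       \<Inter>H \<inter> (\<Inter>i\<in>C. \<Inter>Y\<in>c i. A i Y (card (c i)))" (is "?L \<subseteq> ?R")
    proof
      fix x assume x: "x \<in> ?L"
      have row: "x \<in> A j Y (card (c' j))" if "j \<in> insert i C" "Y \<in> c' j" for j Y
        using x that by blast
      have "x \<in> A i Y (card b)" if "Y \<in> b" for Y
        using row[of i Y] that by (simp add: c'_def)
      then have 1: "x \<in> V Y" if "Y \<in> b" for Y
        using that x Vsub[OF n(2)] by blast
      have 2: "x \<in> U k" if "k \<in> N" for k
        using x decseqD[OF \<open>decseq U\<close> n(1)[OF that]] by blast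
      have "x \<in> D" if D: "D \<in> H" for D
      proof -
        have "D \<in> G \<union> (range U \<union> range V)"
          using D *(2) by (rule subsetD[rotated])
        then consider "D \<in> H \<inter> G" | "D \<in> U ` N" | "D \<in> V ` b"
          unfolding N(2)[symmetric] b(2)[symmetric] using D by blast
        then show ?thesis
        proof cases
          case 1
          with x show ?thesis by simp
        qed (use 1 2 in auto)
      qed
      moreover have "x \<in> A j Y (card (c j))" if "j \<in> C" "Y \<in> c j" for j Y
      proof -
        have "c' j = c j" using that *(4) by (auto simp: c'_def)
        then show ?thesis using row[of j Y] that by simp
      qed
      ultimately show "x \<in> ?R" by blast
    qed
    ultimately show "infinite (\<Inter>H \<inter> (\<Inter>i\<in>C. \<Inter>Y\<in>c i. A i Y (card (c i))))"
      using infinite_super by blast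
  qed
  moreover have "(\<Inter>Y\<in>b. V Y) \<subseteq> U (card b) \<union> B b" if b: "finite b" "b \<noteq> {}" for b
  proof
    fix x assume x: "x \<in> (\<Inter>Y\<in>b. V Y)"
    show "x \<in> U (card b) \<union> B b"
    proof (cases "x \<in> U (card b)")
      case False
      have "x \<in> U 0" using x b by (auto simp: V_def)
      \<comment> \<open>\<open>n\<close> is the last index before \<open>x\<close> drops out of the
        sequence.\<close>
      with False obtain n where n: "n < card b" "x \<in> U n - U (Suc n)"
        using ex_least_nat_less[of "\<lambda>n. x \<notin> U n" "card b"] by blast
      then have "x \<in> (\<Inter>Y\<in>b. A i Y n)" using x by (auto simp: V_def)
      then show ?thesis using linked[OF b(1) n(1)] by blast
    qed simp
  qed
  then have "settled B (G \<union> (range U \<union> range V)) U"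
    unfolding settled_def by blast
  ultimately show ?thesis by blast
qed

section \<open>Transfinite construction of the generating family\<close>

text \<open>A finite \<open>H\<close> already lies in one member of the chain, and rows outside
  every \<open>K x\<close> are outside that of this member.\<close>

lemma independent_mod_chain:
  fixes A :: "'i \<Rightarrow> 'j \<Rightarrow> nat \<Rightarrow> 'a set"
  assumes chain: "\<And>x y. x \<in> D \<Longrightarrow> y \<in> D \<Longrightarrow> G x \<subseteq> G y \<or> G y \<subseteq> G x"
    and indep: "\<And>x. x \<in> D \<Longrightarrow> independent_mod A (G x) (K x)" and "D \<noteq> {}"
  shows "independent_mod A (\<Union>(G ` D)) (\<Union>(K ` D))"
proof (rule independent_modI)
  fix H and C :: "'i set" and b :: "'i \<Rightarrow> 'j set"
  assume *: "finite H" "H \<subseteq> \<Union>(G ` D)" "finite C" "C \<inter> \<Union>(K ` D) = {}"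
    "\<And>i. i \<in> C \<Longrightarrow> finite (b i)"
  have "subset.chain UNIV (G ` D)"
    using chain by (auto simp: subset_chain_def)
  then obtain x where x: "x \<in> D" "H \<subseteq> G x"
    using finite_subset_Union_chain[OF *(1,2)] \<open>D \<noteq> {}\<close> by blast
  show "infinite (\<Inter>H \<inter> (\<Inter>i\<in>C. \<Inter>Y\<in>b i. A i Y (card (b i))))"
  proof (rule independent_modD[OF indep[OF x(1)] *(1) x(2) *(3) _ *(5)])
    show "C \<inter> K x = {}" using *(4) x(1) by blast
  qed
qed

text \<open>Continuum many sequences are settled one by one along a well-order. Each stage spends
  finitely many of the continuum many rows, so a fresh row is always left.\<close>

lemma ex_independent_settled:
  includes cardinal_syntax
  fixes A :: "nat set \<Rightarrow> 'j \<Rightarrow> nat \<Rightarrow> 'a set" and U :: "nat set \<Rightarrow> nat \<Rightarrow> 'a set"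
  assumes mono: "\<And>i Y m n. m \<le> n \<Longrightarrow> A i Y m \<subseteq> A i Y n"
    and linked: "\<And>i b n. finite b \<Longrightarrow> n < card b \<Longrightarrow> (\<Inter>Y\<in>b. A i Y n) \<subseteq> B b"
    and inf: "\<And>C b. finite C \<Longrightarrow> (\<And>i. i \<in> C \<Longrightarrow> finite (b i)) \<Longrightarrow>
           infinite (\<Inter>i\<in>C. \<Inter>Y\<in>b i. A i Y (card (b i)))"
    and dec: "\<And>x. decseq (U x)"
  shows "\<exists>G. (\<forall>H. finite H \<longrightarrow> H \<subseteq> G \<longrightarrow> infinite (\<Inter>H)) \<and> (\<forall>x. settled B G (U x))"
proof -
  \<comment> \<open>A cardinal order is chosen so that each proper initial segment has fewer than
    continuum many elements.\<close>
  define r where "r = |UNIV :: nat set set|"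
  have r: "Card_order r" "Field r = UNIV"
    unfolding r_def by (rule card_of_Card_order, rule Field_card_of)
  then have "Well_order r" by (simp add: card_order_on_well_order_on)
  then have wf: "wf (r - Id)" and tot: "total_on UNIV r" and tr: "trans r" and rfl: "refl_on UNIV r"
    using r(2) by (auto simp: well_order_on_def linear_order_on_def partial_order_on_def preorder_on_def)
  have asym: "antisym r"
    using \<open>Well_order r\<close> by (auto simp: well_order_on_def linear_order_on_def partial_order_on_def)
  define G0 :: "(nat set \<Rightarrow> 'a set set \<times> nat set set) \<Rightarrow> nat set \<Rightarrow> 'a set set"
    where "G0 f x = (\<Union>y\<in>underS r x. fst (f y))" for f x
  define K0 :: "(nat set \<Rightarrow> 'a set set \<times> nat set set) \<Rightarrow> nat set \<Rightarrow> nat set set"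
    where "K0 f x = (\<Union>y\<in>underS r x. snd (f y))" for f x
  \<comment> \<open>\<open>P f x s\<close> reads \<open>f\<close> only strictly below
    \<open>x\<close>, as well-founded choice demands. Independence is carried along so that it
    survives unions of earlier stages.\<close>
  define P where "P f x s \<longleftrightarrow> finite (snd s) \<and> independent_mod A (G0 f x \<union> fst s) (K0 f x \<union> snd s) \<and>
      settled B (G0 f x \<union> fst s) (U x)" for f x s
  have down: "insert x (underS r x) \<subseteq> insert y (underS r y)" if "(x, y) \<in> r" for x y
    using that transD[OF tr _ that] antisymD[OF asym] by (auto simp: underS_def)
  have G0_mono: "G0 f x \<union> fst (f x) \<subseteq> G0 f y \<union> fst (f y)" if "(x, y) \<in> r" for f x y
  proof -
    have "(\<Union>z\<in>insert x (underS r x). fst (f z)) \<subseteq> (\<Union>z\<in>insert y (underS r y). fst (f z))"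
      using down[OF that] by (intro UN_mono) auto
    then show ?thesis unfolding G0_def by auto
  qed
  have chain: "G0 f x \<union> fst (f x) \<subseteq> G0 f y \<union> fst (f y) \<or> G0 f y \<union> fst (f y) \<subseteq> G0 f x \<union> fst (f x)" for f x y
    using G0_mono tot rfl unfolding total_on_def refl_on_def by (metis UNIV_I subset_refl)
  have "\<exists>f. \<forall>x. P f x (f x)"
  proof (rule dependent_wf_choice[OF wf])
    fix f g :: "nat set \<Rightarrow> 'a set set \<times> nat set set" and x s
    assume "\<And>z. (z, x) \<in> r - Id \<Longrightarrow> f z = g z"
    then have "f z = g z" if "z \<in> underS r x" for z
      using that by (auto simp: underS_def)
    then have "G0 f x = G0 g x" "K0 f x = K0 g x"
      by (simp_all add: G0_def K0_def)
    then show "P f x s = P g x s" by (simp add: P_def)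
  next
    fix x and f :: "nat set \<Rightarrow> 'a set set \<times> nat set set"
    assume "\<And>y. (y, x) \<in> r - Id \<Longrightarrow> P f y (f y)"
    then have IH: "P f y (f y)" if "y \<in> underS r x" for y
      using that by (auto simp: underS_def)
    have "independent_mod A (G0 f x) (K0 f x)"
    proof (cases "underS r x = {}")
      case True
      then show ?thesis
        using inf by (intro independent_modI) (auto simp: G0_def)
    next
      case False
      have "underS r y \<subseteq> underS r x" if "y \<in> underS r x" for y
        using that tr asym unfolding underS_def trans_def antisym_def by blast
      then have "G0 f x = (\<Union>y\<in>underS r x. G0 f y \<union> fst (f y))"
        "K0 f x = (\<Union>y\<in>underS r x. K0 f y \<union> snd (f y))"
        unfolding G0_def K0_def by blast+
      moreover have "independent_mod A (\<Union>y\<in>underS r x. G0 f y \<union> fst (f y))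
          (\<Union>y\<in>underS r x. K0 f y \<union> snd (f y))"
        using IH False by (intro independent_mod_chain chain) (auto simp: P_def)
      ultimately show ?thesis by simp
    qed
    \<comment> \<open>Were all rows spent, infinitely many stages would precede \<open>x\<close>,
      and a union of that many finite sets is no larger than the initial segment, hence below the
      continuum.\<close>
    moreover have "K0 f x \<noteq> UNIV"
    proof
      assume eq: "K0 f x = UNIV"
      have fin: "finite (snd (f y))" if "y \<in> underS r x" for y
        using IH[OF that] by (simp add: P_def)
      have "infinite (K0 f x)"
        unfolding eq by (simp add: Finite_Set.finite_set)
      then have "infinite (underS r x)"
        unfolding K0_def using fin by blast
      moreover from this have "|snd (f y)| \<le>o |underS r x|" if "y \<in> underS r x" for y
        using fin[OF that]
        by (meson finite_iff_ordLess_natLeq infinite_iff_natLeq_ordLeq ordLess_imp_ordLeq ordLess_ordLeq_trans)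
      ultimately have "|K0 f x| \<le>o |underS r x|"
        unfolding K0_def by (intro card_of_UNION_ordLeq_infinite) (auto intro: card_of_mono1)
      moreover have "|underS r x| <o r"
        using r by (intro card_of_underS) auto
      ultimately show False
        unfolding eq r_def[symmetric] using not_ordLess_ordLeq by blast
    qed
    then obtain i where "i \<notin> K0 f x" by blast
    ultimately have "\<exists>G' K'. finite K' \<and> independent_mod A (G0 f x \<union> G') (K0 f x \<union> K') \<and>
        settled B (G0 f x \<union> G') (U x)"
      using mono linked dec by (intro settle_step[where A = A and B = B and i = i])
    then obtain G' K' where "finite K'" "independent_mod A (G0 f x \<union> G') (K0 f x \<union> K')"
        "settled B (G0 f x \<union> G') (U x)" by blast
    then show "\<exists>s. P f x s"
      by (intro exI[of _ "(G', K')"]) (simp add: P_def)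
  qed
  then obtain f where f: "\<And>x. P f x (f x)" by blast
  define G where "G = (\<Union>x. G0 f x \<union> fst (f x))"
  have "independent_mod A G (\<Union>x. K0 f x \<union> snd (f x))"
    unfolding G_def using f by (intro independent_mod_chain chain) (auto simp: P_def)
  then have "infinite (\<Inter>H)" if "finite H" "H \<subseteq> G" for H
    using independent_modD[of A G _ H "{}"] that by simp
  moreover have "settled B G (U x)" for x
  proof -
    have "settled B (G0 f x \<union> fst (f x)) (U x)" using f[of x] by (simp add: P_def)
    then show ?thesis
      by (rule settled_mono) (auto simp: G_def)
  qed
  ultimately show ?thesis by blast
qed

text \<open>The bound \<open>J b\<close> does not depend on the sequence \<open>U\<close>. This uniformity is what allows the
  witnesses \<open>V\<close> to be chosen in infinitely many copies of \<open>\<omega>\<close> at once.\<close>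

definition uniformly_OK :: "('j set \<Rightarrow> nat) \<Rightarrow> nat filter \<Rightarrow> bool" where
  "uniformly_OK J p \<longleftrightarrow>
     (\<forall>U. (\<forall>n. eventually (\<lambda>x. x \<in> U n) p) \<longrightarrow>
        (\<exists>V. (\<forall>Y. eventually (\<lambda>x. x \<in> V Y) p) \<and>
             (\<forall>b. finite b \<longrightarrow> b \<noteq> {} \<longrightarrow> (\<Inter>Y\<in>b. V Y) \<subseteq> U (card b) \<union> {..<J b})))"

lemma uniformly_OKD:
  assumes "uniformly_OK J p" "\<And>n. eventually (\<lambda>x. x \<in> U n) p"
  shows "\<exists>V. (\<forall>Y. eventually (\<lambda>x. x \<in> V Y) p) \<and>
             (\<forall>b. finite b \<longrightarrow> b \<noteq> {} \<longrightarrow> (\<Inter>Y\<in>b. V Y) \<subseteq> U (card b) \<union> {..<J b})"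
  using assms(1)[unfolded uniformly_OK_def, THEN spec, of U] assms(2) by iprover

text \<open>One subset of \<omega> codes a whole sequence, so settling the coded sequences settles
  all. Constant sequences make the filter an ultrafilter; sequences from \<open>p\<close> cannot be
  excluded and so get witnesses.\<close>

lemma ex_uniformly_OK_ultrafilter:
  obtains p and J :: "nat set set \<Rightarrow> nat"
  where "is_ultrafilter p" "p \<le> sequentially" "uniformly_OK J p"
proof -
  obtain A :: "nat set \<Rightarrow> nat set \<Rightarrow> nat \<Rightarrow> nat set" and J :: "nat set set \<Rightarrow> nat"
    where A: "\<forall>X Y m n. m \<le> n \<longrightarrow> A X Y m \<subseteq> A X Y n"
      "\<forall>X b n. finite b \<longrightarrow> n < card b \<longrightarrow> (\<Inter>Y\<in>b. A X Y n) \<subseteq> {..<J b}"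
      "\<forall>C b. finite C \<longrightarrow> (\<forall>X\<in>C. finite (b X)) \<longrightarrow>
        infinite (\<Inter>X\<in>C. \<Inter>Y\<in>b X. A X Y (card (b X)))"
    using ex_independent_linked_family by (elim exE conjE) (rule that)
  \<comment> \<open>Intersecting initial segments makes the coded sequence decreasing, as the
    settling step requires.\<close>
  define U where "U x n = (\<Inter>m\<le>n. {j. prod_encode (m, j) \<in> x})" for x n
  have dec: "decseq (U x)" for x
    by (auto simp: decseq_def U_def)
  obtain G where G: "\<And>H. finite H \<Longrightarrow> H \<subseteq> G \<Longrightarrow> infinite (\<Inter>H)"
    and settled: "\<And>x. settled (\<lambda>b. {..<J b}) G (U x)"
    using ex_independent_settled[where A = A and U = U, OF A[rule_format] dec] by blast
  have settled': "settled (\<lambda>b. {..<J b}) G (\<lambda>n. \<Inter>m\<le>n. W m)" for W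
  proof -
    have "U {prod_encode (m, j) |m j. j \<in> W m} = (\<lambda>n. \<Inter>m\<le>n. W m)"
      by (auto simp: U_def fun_eq_iff)
    with settled[of "{prod_encode (m, j) |m j. j \<in> W m}"] show ?thesis by (simp only:)
  qed
  \<comment> \<open>This is the filter generated by \<open>G\<close> and the cofinite sets.\<close>
  define Q where "Q P \<longleftrightarrow> (\<exists>H. finite H \<and> H \<subseteq> G \<and> finite (\<Inter>H \<inter> {x. \<not> P x}))" for P
  have "is_filter Q"
  proof
    show "Q (\<lambda>x. True)" by (auto simp: Q_def)
    show "Q (\<lambda>x. P x \<and> R x)" if "Q P" "Q R" for P R
    proof -
      from \<open>Q P\<close> obtain H where H: "finite H" "H \<subseteq> G" "finite (\<Inter>H \<inter> {x. \<not> P x})"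
        unfolding Q_def by blast
      from \<open>Q R\<close> obtain H' where H': "finite H'" "H' \<subseteq> G" "finite (\<Inter>H' \<inter> {x. \<not> R x})"
        unfolding Q_def by blast
      have "\<Inter>(H \<union> H') \<inter> {x. \<not> (P x \<and> R x)} \<subseteq> (\<Inter>H \<inter> {x. \<not> P x}) \<union> (\<Inter>H' \<inter> {x. \<not> R x})"
        by auto
      then have "finite (\<Inter>(H \<union> H') \<inter> {x. \<not> (P x \<and> R x)})"
        by (rule finite_subset) (simp add: H(3) H'(3))
      then show ?thesis
        unfolding Q_def using H H' by (intro exI[of _ "H \<union> H'"]) simp
    qed
    show "Q R" if le: "\<forall>x. P x \<longrightarrow> R x" and "Q P" for P R
    proof -
      from \<open>Q P\<close> obtain H where H: "finite H" "H \<subseteq> G" "finite (\<Inter>H \<inter> {x. \<not> P x})"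
        unfolding Q_def by blast
      have "\<Inter>H \<inter> {x. \<not> R x} \<subseteq> \<Inter>H \<inter> {x. \<not> P x}" using le by auto
      then have "finite (\<Inter>H \<inter> {x. \<not> R x})" using H(3) by (rule finite_subset)
      then show ?thesis unfolding Q_def using H by blast
    qed
  qed
  define p where "p = Abs_filter Q"
  have ev: "eventually P p \<longleftrightarrow> Q P" for P
    unfolding p_def by (rule eventually_Abs_filter) fact
  have notbot: "\<not> Q (\<lambda>x. False)"
    using G by (auto simp: Q_def)
  have mem: "Q (\<lambda>x. x \<in> X)" if "X \<in> G" for X
  proof -
    have "X \<inter> {x. x \<notin> X} = {}" by auto
    then show ?thesis unfolding Q_def using that by (intro exI[of _ "{X}"]) simp
  qed
  have cofin: "Q P" if "finite {x. \<not> P x}" for P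
    unfolding Q_def using that by (intro exI[of _ "{}"]) auto
  have const: "(\<Inter>m\<le>n. X) = X" for n :: nat and X :: "nat set"
    by auto
  \<comment> \<open>For a constant sequence, exclusion puts the complement into the filter, and the
    other alternative puts the set itself into \<open>G\<close>.\<close>
  have ultra: "Q P \<or> Q (\<lambda>x. \<not> P x)" for P
    using settled'[of "\<lambda>_. {x. P x}"] unfolding settled_def const
  proof (elim disjE exE conjE)
    fix n H assume "finite H" "H \<subseteq> G" "finite (\<Inter>H \<inter> {x. P x})"
    then have "Q (\<lambda>x. \<not> P x)" by (auto simp: Q_def)
    then show ?thesis ..
  next
    assume "range (\<lambda>n::nat. {x. P x}) \<subseteq> G"
    then have "{x. P x} \<in> G" by auto
    then show ?thesis using mem by force
  qed
  show thesis
  proof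
    show "is_ultrafilter p"
      unfolding is_ultrafilter_def trivial_limit_def ev using ultra notbot by blast
    show "p \<le> sequentially"
      by (rule filter_leI) (auto simp: ev eventually_cofinite cofinite_eq_sequentially[symmetric] intro: cofin)
    show "uniformly_OK J p"
      unfolding uniformly_OK_def
    proof (intro allI impI)
      fix W :: "nat \<Rightarrow> nat set"
      assume W: "\<forall>n. eventually (\<lambda>x. x \<in> W n) p"
      \<comment> \<open>This rules out the first alternative of \<open>settled\<close>: an excluded
        sequence has a finite intersection whose complement is in \<open>p\<close>.\<close>
      have "\<not> finite (\<Inter>H \<inter> (\<Inter>m\<le>n. W m))" if "finite H" "H \<subseteq> G" for n H
      proof
        assume "finite (\<Inter>H \<inter> (\<Inter>m\<le>n. W m))"
        then have "eventually (\<lambda>x. x \<notin> (\<Inter>m\<le>n. W m)) p"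
          unfolding ev Q_def not_not Collect_mem_eq using that by blast
        moreover have "eventually (\<lambda>x. \<forall>m\<in>{..n}. x \<in> W m) p"
          using W by (intro eventually_ball_finite) auto
        ultimately have "eventually (\<lambda>x. False) p"
          by eventually_elim auto
        then show False using notbot by (simp add: ev)
      qed
      then obtain V where V: "range V \<subseteq> G"
        "\<And>b. finite b \<Longrightarrow> b \<noteq> {} \<Longrightarrow> (\<Inter>Y\<in>b. V Y) \<subseteq> (\<Inter>m\<le>card b. W m) \<union> {..<J b}"
        using settled'[of W] unfolding settled_def by metis
      show "\<exists>V. (\<forall>Y. eventually (\<lambda>x. x \<in> V Y) p) \<and>
             (\<forall>b. finite b \<longrightarrow> b \<noteq> {} \<longrightarrow> (\<Inter>Y\<in>b. V Y) \<subseteq> W (card b) \<union> {..<J b})"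
      proof (intro exI conjI allI impI)
        show "eventually (\<lambda>x. x \<in> V Y) p" for Y
          using V(1) mem by (auto simp: ev)
        show "(\<Inter>Y\<in>b. V Y) \<subseteq> W (card b) \<union> {..<J b}" if "finite b" "b \<noteq> {}" for b
          using V(2)[OF that] by blast
      qed
    qed
  qed
qed

section \<open>Finitely additive measures\<close>

text \<open>The total mass is left free so that a measure can be restricted to a single
  column.\<close>

definition finitely_additive :: "('a set \<Rightarrow> real) \<Rightarrow> bool" where
  "finitely_additive m \<longleftrightarrow>
     (\<forall>A. 0 \<le> m A) \<and> (\<forall>A B. A \<inter> B = {} \<longrightarrow> m (A \<union> B) = m A + m B)"

context
  fixes m :: "'a set \<Rightarrow> real"
  assumes m: "finitely_additive m"
begin

lemma fa_nonneg: "0 \<le> m A"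
  using m by (simp add: finitely_additive_def)

lemma fa_Un: "A \<inter> B = {} \<Longrightarrow> m (A \<union> B) = m A + m B"
  using m by (simp add: finitely_additive_def)

lemma fa_empty: "m {} = 0"
  using fa_Un[of "{}" "{}"] by simp

lemma fa_mono:
  assumes "A \<subseteq> B" shows "m A \<le> m B"
proof -
  have "A \<union> (B - A) = B" using assms by auto
  then show ?thesis
    using fa_Un[of A "B - A"] fa_nonneg[of "B - A"] by auto
qed

lemma fa_subadd: "m (A \<union> B) \<le> m A + m B"
  using fa_Un[of A "B - A"] fa_mono[of "B - A" B] by auto

lemma fa_subadd_UN: "finite I \<Longrightarrow> m (\<Union>i\<in>I. A i) \<le> (\<Sum>i\<in>I. m (A i))"
proof (induction I rule: finite_induct)
  case (insert i I)
  then show ?case using fa_subadd[of "A i" "\<Union>(A ` I)"] by simp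
qed (simp add: fa_empty)

lemma fa_UN: "finite I \<Longrightarrow> disjoint_family_on A I \<Longrightarrow> m (\<Union>i\<in>I. A i) = (\<Sum>i\<in>I. m (A i))"
proof (induction I rule: finite_induct)
  case (insert i I)
  then have "A i \<inter> \<Union>(A ` I) = {}" by (auto simp: disjoint_family_on_def)
  moreover have "disjoint_family_on A I"
    using insert.prems by (auto simp: disjoint_family_on_def)
  ultimately show ?case using insert fa_Un[of "A i" "\<Union>(A ` I)"] by simp
qed (simp add: fa_empty)

text \<open>This integrates the bound \<open>k\<close> on a sum of indicators. The space splits into
  cells \<open>P t\<close> by membership pattern; exchanging the sums counts each cell
  \<open>card t\<close> times.\<close>

lemma sum_le_of_multiplicity_le:
  assumes b: "finite b" and mult: "\<And>x. card {Y \<in> b. x \<in> W Y} \<le> k"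
  shows "(\<Sum>Y\<in>b. m (W Y)) \<le> real k * m UNIV"
proof -
  define P where "P t = {x. {Y \<in> b. x \<in> W Y} = t}" for t
  have dis: "disjoint_family_on P T" for T
    by (auto simp: disjoint_family_on_def P_def)
  have fin: "finite (Pow b)" using b by simp
  have "(\<Sum>Y\<in>b. m (W Y)) = (\<Sum>Y\<in>b. \<Sum>t\<in>Pow b. if Y \<in> t then m (P t) else 0)"
  proof (rule sum.cong)
    fix Y assume "Y \<in> b"
    then have "W Y = (\<Union>t\<in>{t \<in> Pow b. Y \<in> t}. P t)"
      by (auto simp: P_def)
    then have "m (W Y) = (\<Sum>t\<in>{t \<in> Pow b. Y \<in> t}. m (P t))"
      using fa_UN[OF _ dis, of "{t \<in> Pow b. Y \<in> t}"] fin by simp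
    then show "m (W Y) = (\<Sum>t\<in>Pow b. if Y \<in> t then m (P t) else 0)"
      using sum.inter_filter[OF fin, of "\<lambda>t. m (P t)" "\<lambda>t. Y \<in> t"] by simp
  qed simp
  also have "\<dots> = (\<Sum>t\<in>Pow b. \<Sum>Y\<in>b. if Y \<in> t then m (P t) else 0)"
    by (rule sum.swap)
  also have "\<dots> = (\<Sum>t\<in>Pow b. real (card t) * m (P t))"
  proof (rule sum.cong)
    fix t assume "t \<in> Pow b"
    then have "b \<inter> t = t" by auto
    then show "(\<Sum>Y\<in>b. if Y \<in> t then m (P t) else 0) = real (card t) * m (P t)"
      using sum.inter_restrict[OF b, of "\<lambda>_. m (P t)" t] by simp
  qed simp
  also have "\<dots> \<le> (\<Sum>t\<in>Pow b. real k * m (P t))"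
  proof (rule sum_mono)
    fix t
    \<comment> \<open>A pattern longer than \<open>k\<close> is realised by no point, so its cell is
      empty and has mass zero.\<close>
    show "real (card t) * m (P t) \<le> real k * m (P t)"
    proof (cases "P t = {}")
      case False
      then have "card t \<le> k" using mult by (auto simp: P_def)
      then show ?thesis using fa_nonneg by (intro mult_right_mono) auto
    qed (simp add: fa_empty)
  qed
  also have "\<dots> = real k * m (\<Union>t\<in>Pow b. P t)"
    using fa_UN[OF fin dis] by (simp add: sum_distrib_left)
  also have "\<dots> \<le> real k * m UNIV"
    by (intro mult_left_mono fa_mono) auto
  finally show ?thesis .
qed

text \<open>If all \<open>V Y\<close> had positive mass, then infinitely many would have mass at least some \<open>e\<close>.
  Among \<open>N\<close> of these the points lying in \<open>k\<close> or more of them have mass at most \<open>m (U k)\<close>,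
  so \<open>N * e \<le> k * m UNIV + N * m (U k)\<close>, which is absurd once \<open>m (U k) < e\<close> and \<open>N\<close> is large.\<close>

lemma ex_null_of_OK:
  fixes V :: "'j \<Rightarrow> 'a set" and U :: "nat \<Rightarrow> 'a set"
  assumes unc: "uncountable (UNIV :: 'j set)"
    and null: "\<And>b. finite b \<Longrightarrow> b \<noteq> {} \<Longrightarrow> m ((\<Inter>Y\<in>b. V Y) - U (card b)) = 0"
    and small: "\<And>k. m (U k) < inverse (real (Suc k))"
  shows "\<exists>Y. m (V Y) = 0"
proof (rule ccontr)
  assume "\<not> ?thesis"
  then have pos: "m (V Y) > 0" for Y using fa_nonneg[of "V Y"] by (simp add: less_le)
  \<comment> \<open>Countably many thresholds cover an uncountable index type, so one of them is
    exceeded uncountably often.\<close>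
  have "(\<Union>n. {Y. m (V Y) > inverse (real (Suc n))}) = UNIV"
    using reals_Archimedean[OF pos] by auto
  moreover have "countable (\<Union>n. {Y. m (V Y) > inverse (real (Suc n))})"
    if "\<And>n. countable {Y. m (V Y) > inverse (real (Suc n))}"
    using that by (intro countable_UN) auto
  ultimately obtain n where "uncountable {Y. m (V Y) > inverse (real (Suc n))}"
    using unc by metis
  then have inf: "infinite {Y. m (V Y) > inverse (real (Suc n))}"
    using countable_finite by blast
  define e where "e = inverse (real (Suc n))"
  have "e > 0" by (simp add: e_def)
  \<comment> \<open>The shift by one makes \<open>k\<close> positive and gives
    \<open>m (U k) < 1/(n+2) < e\<close>.\<close>
  define k where "k = Suc n"
  have k: "k > 0" "m (U k) < e"
    using less_trans[OF small[of k], of e] by (simp_all add: e_def k_def field_simps)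
  obtain N where N: "real k * m UNIV < real N * (e - m (U k))"
    using reals_Archimedean3[of "e - m (U k)"] k by auto
  obtain b where b: "finite b" "card b = N" "b \<subseteq> {Y. m (V Y) > e}"
    using infinite_arbitrarily_large[OF inf] unfolding e_def by blast
  define C where "C = {c. c \<subseteq> b \<and> card c = k}"
  have fin: "finite C" using b(1) by (auto simp: C_def)
  \<comment> \<open>\<open>Z\<close> consists of the points in at least \<open>k\<close> of the
    chosen sets. It lies in \<open>U k\<close> up to finitely many null sets, and off
    \<open>Z\<close> the multiplicity stays below \<open>k\<close>.\<close>
  define Z where "Z = (\<Union>c\<in>C. \<Inter>Y\<in>c. V Y)"
  have "Z \<subseteq> U k \<union> (\<Union>c\<in>C. (\<Inter>Y\<in>c. V Y) - U k)"
    by (auto simp: Z_def)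
  then have "m Z \<le> m (U k \<union> (\<Union>c\<in>C. (\<Inter>Y\<in>c. V Y) - U k))"
    by (rule fa_mono)
  also have "\<dots> \<le> m (U k) + m (\<Union>c\<in>C. (\<Inter>Y\<in>c. V Y) - U k)"
    by (rule fa_subadd)
  also have "m (\<Union>c\<in>C. (\<Inter>Y\<in>c. V Y) - U k) \<le> (\<Sum>c\<in>C. m ((\<Inter>Y\<in>c. V Y) - U k))"
    by (rule fa_subadd_UN[OF fin])
  also have "\<dots> = 0"
  proof (rule sum.neutral, rule ballI)
    fix c assume "c \<in> C"
    then have "finite c" "c \<noteq> {}" "card c = k"
      using b(1) \<open>k > 0\<close> by (auto simp: C_def finite_subset)
    then show "m ((\<Inter>Y\<in>c. V Y) - U k) = 0" using null by metis
  qed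
  finally have Z: "m Z \<le> m (U k)" by simp
  have "real N * e = (\<Sum>Y\<in>b. e)" using b by simp
  also have "\<dots> \<le> (\<Sum>Y\<in>b. m (V Y - Z) + m Z)"
  proof (rule sum_mono)
    fix Y assume "Y \<in> b"
    then have "e \<le> m (V Y)" using b by auto
    also have "\<dots> \<le> m ((V Y - Z) \<union> Z)" by (rule fa_mono) auto
    also have "\<dots> \<le> m (V Y - Z) + m Z" by (rule fa_subadd)
    finally show "e \<le> m (V Y - Z) + m Z" .
  qed
  also have "\<dots> = (\<Sum>Y\<in>b. m (V Y - Z)) + real N * m Z"
    using b by (simp add: sum.distrib)
  also have "(\<Sum>Y\<in>b. m (V Y - Z)) \<le> real k * m UNIV"
  proof (rule sum_le_of_multiplicity_le[OF b(1)])
    fix x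
    show "card {Y \<in> b. x \<in> V Y - Z} \<le> k"
    proof (rule ccontr)
      assume "\<not> ?thesis"
      then obtain c where c: "c \<subseteq> {Y \<in> b. x \<in> V Y - Z}" "card c = k"
        using obtain_subset_with_card_n[of k "{Y \<in> b. x \<in> V Y - Z}"] by auto
      then have "c \<in> C" by (auto simp: C_def)
      then have "x \<in> Z" using c by (auto simp: Z_def)
      then show False using c \<open>k > 0\<close> by auto
    qed
  qed
  also have "real N * m Z \<le> real N * m (U k)"
    using Z by (intro mult_left_mono) auto
  finally show False using N by (simp add: algebra_simps)
qed

end

lemma uncountable_UNIV_nat_set_set: "uncountable (UNIV :: nat set set)"
proof
  assume "countable (UNIV :: nat set set)"
  then have "range (from_nat_into (UNIV :: nat set set)) = UNIV"
    by (intro range_from_nat_into) auto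
  then have "\<forall>X. \<exists>n. X = from_nat_into (UNIV :: nat set set) n"
    by (metis UNIV_I imageE)
  then show False
    using Cantors_theorem[of "UNIV :: nat set"] by (metis Pow_UNIV \<open>range (from_nat_into UNIV) = UNIV\<close>)
qed

text \<open>Members of \<open>p\<close> of mass below \<open>1/(k+1)\<close> serve as
  \<open>U k\<close>. The errors of the OK witnesses are finite, hence null, so the double count
  applies.\<close>

lemma uniformly_OK_null:
  fixes J :: "'j set \<Rightarrow> nat"
  assumes "uncountable (UNIV :: 'j set)" "uniformly_OK J p" and m: "finitely_additive m"
    and fin: "\<And>X. finite X \<Longrightarrow> m X = 0"
    and small: "\<And>e. e > 0 \<Longrightarrow> \<exists>X. eventually (\<lambda>x. x \<in> X) p \<and> m X < e"
  shows "\<exists>X. eventually (\<lambda>x. x \<in> X) p \<and> m X = 0"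
proof -
  have "\<forall>k. \<exists>X. eventually (\<lambda>x. x \<in> X) p \<and> m X < inverse (real (Suc k))"
    by (intro allI small) simp
  then obtain U where U: "\<And>k. eventually (\<lambda>x. x \<in> U k) p" "\<And>k. m (U k) < inverse (real (Suc k))"
    by metis
  obtain V where V: "\<And>Y. eventually (\<lambda>x. x \<in> V Y) p"
    "\<And>b. finite b \<Longrightarrow> b \<noteq> {} \<Longrightarrow> (\<Inter>Y\<in>b. V Y) \<subseteq> U (card b) \<union> {..<J b}"
    using uniformly_OKD[OF assms(2) U(1)] by iprover
  have "\<exists>Y. m (V Y) = 0"
  proof (rule ex_null_of_OK[OF m assms(1)])
    fix b :: "'j set" assume "finite b" "b \<noteq> {}"
    then have "(\<Inter>Y\<in>b. V Y) - U (card b) \<subseteq> {..<J b}" using V(2) by blast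
    then show "m ((\<Inter>Y\<in>b. V Y) - U (card b)) = 0"
      by (intro fin) (rule finite_subset, auto)
  qed (rule U(2))
  then show ?thesis using V(1) by blast
qed

section \<open>The Fubini square\<close>

definition column_filter :: "nat filter \<Rightarrow> nat \<Rightarrow> nat filter" where
  "column_filter p n = filtermap (\<lambda>j. prod_encode (n, j)) p"

definition fubini_square :: "nat filter \<Rightarrow> nat filter" where
  "fubini_square p =
     Abs_filter (\<lambda>P. eventually (\<lambda>n. eventually (\<lambda>j. P (prod_encode (n, j))) p) p)"

lemma eventually_column_filter:
  "eventually P (column_filter p n) \<longleftrightarrow> eventually (\<lambda>j. P (prod_encode (n, j))) p"
  by (simp add: column_filter_def eventually_filtermap)

lemma eventually_fubini_square:
  "eventually P (fubini_square p) \<longleftrightarrow> eventually (\<lambda>n. eventually P (column_filter p n)) p"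
  unfolding fubini_square_def eventually_column_filter
proof (rule eventually_Abs_filter, unfold_locales)
  show "eventually (\<lambda>n. eventually (\<lambda>j. P (prod_encode (n, j)) \<and> Q (prod_encode (n, j))) p) p"
    if "eventually (\<lambda>n. eventually (\<lambda>j. P (prod_encode (n, j))) p) p"
      "eventually (\<lambda>n. eventually (\<lambda>j. Q (prod_encode (n, j))) p) p" for P Q
    using that by eventually_elim (rule eventually_conj)
  show "eventually (\<lambda>n. eventually (\<lambda>j. Q (prod_encode (n, j))) p) p"
    if "\<forall>x. P x \<longrightarrow> Q x" "eventually (\<lambda>n. eventually (\<lambda>j. P (prod_encode (n, j))) p) p" for P Q
    using that(2) by eventually_elim (use that(1) in \<open>auto elim: eventually_mono\<close>)
qed simp

text \<open>OK witnesses are taken for the column index and inside every column, all with the same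
  \<open>J\<close>. Requiring \<open>n \<le> j\<close> makes \<open>n \<ge> J b\<close> clear both
  error bounds at once, so errors survive only in the columns \<open>n < J b\<close>, where the sets
  \<open>B n\<close> make them null.\<close>

lemma fubini_square_null:
  fixes J :: "'j set \<Rightarrow> nat"
  assumes unc: "uncountable (UNIV :: 'j set)" and OK: "uniformly_OK J p" and "p \<le> sequentially"
    and m: "finitely_additive m"
    and fin: "\<And>X. finite X \<Longrightarrow> m X = 0"
    and col: "\<And>n e. e > 0 \<Longrightarrow> \<exists>X. eventually (\<lambda>x. x \<in> X) (column_filter p n) \<and> m X < e"
    and small: "\<And>e. e > 0 \<Longrightarrow> \<exists>X. eventually (\<lambda>x. x \<in> X) (fubini_square p) \<and> m X < e"
  shows "\<exists>X. eventually (\<lambda>x. x \<in> X) (fubini_square p) \<and> m X = 0"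
proof -
  define c where "c n j = prod_encode (n, j)" for n j :: nat
  have c_inj: "c n j = c n' j' \<longleftrightarrow> n = n' \<and> j = j'" for n j n' j'
    by (simp add: c_def)
  have "\<exists>B. eventually (\<lambda>j. j \<in> B) p \<and> m (c n ` B) = 0" for n
  proof (rule uniformly_OK_null[OF unc OK])
    show "finitely_additive (\<lambda>B. m (c n ` B))"
      unfolding finitely_additive_def
    proof (intro conjI allI impI)
      fix A B :: "nat set" assume "A \<inter> B = {}"
      then have "c n ` A \<inter> c n ` B = {}" by (auto simp: c_inj)
      then show "m (c n ` (A \<union> B)) = m (c n ` A) + m (c n ` B)"
        by (simp add: image_Un fa_Un[OF m])
    qed (rule fa_nonneg[OF m])
    show "m (c n ` X) = 0" if "finite X" for X using that fin by simp
    show "\<exists>X. eventually (\<lambda>x. x \<in> X) p \<and> m (c n ` X) < e" if e: "e > 0" for e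
    proof -
      obtain X where "eventually (\<lambda>x. x \<in> X) (column_filter p n)" "m X < e" using col[OF e] by blast
      moreover have "m (c n ` (c n -` X)) \<le> m X" by (rule fa_mono[OF m]) auto
      ultimately show ?thesis
        by (intro exI[of _ "c n -` X"]) (auto simp: eventually_column_filter c_def)
    qed
  qed
  then obtain B where B: "\<And>n. eventually (\<lambda>j. j \<in> B n) p" "\<And>n. m (c n ` B n) = 0" by metis
  have "\<forall>k. \<exists>X. eventually (\<lambda>x. x \<in> X) (fubini_square p) \<and> m X < inverse (real (Suc k))"
    by (intro allI small) simp
  then obtain A where A: "\<And>k. eventually (\<lambda>x. x \<in> A k) (fubini_square p)"
    "\<And>k. m (A k) < inverse (real (Suc k))" by metis
  \<comment> \<open>\<open>D k\<close> collects the columns in which \<open>A k\<close> is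
    large.\<close>
  define D where "D k = {n. eventually (\<lambda>j. c n j \<in> A k) p}" for k
  have D: "eventually (\<lambda>n. n \<in> D k) p" for k
    using A(1)[of k] by (simp add: D_def eventually_fubini_square eventually_column_filter c_def)
  obtain V where V: "\<And>Y. eventually (\<lambda>x. x \<in> V Y) p"
    "\<And>b. finite b \<Longrightarrow> b \<noteq> {} \<Longrightarrow> (\<Inter>Y\<in>b. V Y) \<subseteq> D (card b) \<union> {..<J b}"
    using uniformly_OKD[OF OK D] by iprover
  \<comment> \<open>Outside \<open>D k\<close> the set \<open>E n k\<close> is everything, so it
    belongs to \<open>p\<close> for all \<open>n\<close> and \<open>k\<close> and every column has
    witnesses.\<close>
  define E where "E n k = {j. n \<in> D k \<longrightarrow> c n j \<in> A k}" for n k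
  have "eventually (\<lambda>j. j \<in> E n k) p" for n k
    by (cases "n \<in> D k") (simp_all add: E_def D_def)
  then have "\<exists>V. (\<forall>Y. eventually (\<lambda>x. x \<in> V Y) p) \<and>
      (\<forall>b. finite b \<longrightarrow> b \<noteq> {} \<longrightarrow> (\<Inter>Y\<in>b. V Y) \<subseteq> E n (card b) \<union> {..<J b})" for n
    by (rule uniformly_OKD[OF OK])
  then obtain F where F: "\<And>n Y. eventually (\<lambda>x. x \<in> F n Y) p"
    "\<And>n b. finite b \<Longrightarrow> b \<noteq> {} \<Longrightarrow> (\<Inter>Y\<in>b. F n Y) \<subseteq> E n (card b) \<union> {..<J b}"
    by metis
  define W where "W Y = {c n j |n j. n \<in> V Y \<and> j \<in> F n Y \<and> j \<in> B n \<and> n \<le> j}" for Y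
  have W: "eventually (\<lambda>x. x \<in> W Y) (fubini_square p)" for Y
    unfolding eventually_fubini_square
  proof (rule eventually_mono[OF V(1)])
    fix n assume "n \<in> V Y"
    have "eventually (\<lambda>j. n \<le> j) p"
      using filter_leD[OF \<open>p \<le> sequentially\<close> eventually_ge_at_top] .
    with F(1)[of n Y] B(1)[of n] show "eventually (\<lambda>x. x \<in> W Y) (column_filter p n)"
      unfolding eventually_column_filter
    proof eventually_elim
      case (elim j)
      then show ?case using \<open>n \<in> V Y\<close> unfolding W_def c_def by blast
    qed
  qed
  have "\<exists>Y. m (W Y) = 0"
  proof (rule ex_null_of_OK[OF m unc])
    fix b :: "'j set" assume b: "finite b" "b \<noteq> {}"
    have "(\<Inter>Y\<in>b. W Y) - A (card b) \<subseteq> (\<Union>n<J b. c n ` B n)"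
    proof
      fix x assume x: "x \<in> (\<Inter>Y\<in>b. W Y) - A (card b)"
      obtain Y0 where "Y0 \<in> b" using b(2) by blast
      with x have "x \<in> W Y0" by blast
      then obtain n j where nj: "x = c n j"
        unfolding W_def by blast
      have *: "n \<in> V Y" "j \<in> F n Y" "j \<in> B n" "n \<le> j" if "Y \<in> b" for Y
        using x that unfolding W_def nj by (auto simp: c_inj)
      \<comment> \<open>Otherwise \<open>J b \<le> n \<le> j\<close>, so neither coordinate is an
        error: \<open>n\<close> is in \<open>D (card b)\<close>, \<open>j\<close> is in
        \<open>E n (card b)\<close>, and the point falls into \<open>A (card b)\<close>.\<close>
      have "n < J b"
      proof (rule ccontr)
        assume "\<not> n < J b"
        then have "n \<in> D (card b)" "j \<in> E n (card b)"
          using V(2)[OF b] F(2)[OF b, of n] * \<open>Y0 \<in> b\<close> by fastforce+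
        then show False using x by (auto simp: E_def nj)
      qed
      then show "x \<in> (\<Union>n<J b. c n ` B n)"
        using *[OF \<open>Y0 \<in> b\<close>] nj by blast
    qed
    then have "m ((\<Inter>Y\<in>b. W Y) - A (card b)) \<le> m (\<Union>n<J b. c n ` B n)"
      by (rule fa_mono[OF m])
    also have "\<dots> \<le> (\<Sum>n<J b. m (c n ` B n))"
      by (rule fa_subadd_UN[OF m]) simp
    also have "\<dots> = 0" using B(2) by simp
    finally show "m ((\<Inter>Y\<in>b. W Y) - A (card b)) = 0"
      using fa_nonneg[OF m] by (simp add: order_antisym)
  qed (rule A(2))
  then show ?thesis using W by blast
qed

section \<open>Measures on the remainder\<close>

lemma is_ultrafilterD: "is_ultrafilter u \<Longrightarrow> \<not> eventually P u \<Longrightarrow> eventually (\<lambda>x. \<not> P x) u"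
  by (auto simp: is_ultrafilter_def)

lemma is_ultrafilter_contradiction:
  "is_ultrafilter u \<Longrightarrow> eventually P u \<Longrightarrow> eventually (\<lambda>x. \<not> P x) u \<Longrightarrow> False"
  using eventually_conj[of P u "\<lambda>x. \<not> P x"] by (simp add: is_ultrafilter_def)

text \<open>An ultrafilter with a singleton member is principal; one without contains all
  complements of finite sets.\<close>

lemma topspace_omega_star_iff: "u \<in> topspace omega_star \<longleftrightarrow> is_ultrafilter u \<and> u \<le> sequentially"
proof -
  have "u \<le> sequentially \<longleftrightarrow> (\<forall>n. u \<noteq> principal {n})" if u: "is_ultrafilter u"
  proof
    assume le: "u \<le> sequentially"
    show "\<forall>n. u \<noteq> principal {n}"
    proof (intro allI notI)
      fix n assume "u = principal {n}"
      then show False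
        using filter_leD[OF le eventually_gt_at_top[of n]] by (simp add: eventually_principal)
    qed
  next
    assume np: "\<forall>n. u \<noteq> principal {n}"
    have ne: "eventually (\<lambda>x. x \<noteq> n) u" for n
    proof (rule ccontr)
      assume "\<not> ?thesis"
      then have eq: "eventually (\<lambda>x. x = n) u"
        using is_ultrafilterD[OF u] by force
      have "eventually P u \<longleftrightarrow> P n" for P
      proof
        assume "P n"
        with eq show "eventually P u" by (auto elim: eventually_mono)
      next
        assume "eventually P u"
        then have "eventually (\<lambda>x. \<not> P x) u \<Longrightarrow> False"
          using is_ultrafilter_contradiction[OF u] by blast
        with eq show "P n" by (metis (mono_tags, lifting) eventually_mono)
      qed
      then have "u = principal {n}" by (simp add: filter_eq_iff eventually_principal)
      with np show False by blast
    qed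
    show "u \<le> sequentially"
    proof (rule filter_leI)
      fix P assume "eventually P sequentially"
      then obtain N where N: "\<And>x. x \<ge> N \<Longrightarrow> P x" by (auto simp: eventually_sequentially)
      have "eventually (\<lambda>x. \<forall>n\<in>{..<N}. x \<noteq> n) u"
        using ne by (intro eventually_ball_finite) auto
      then show "eventually P u"
        by eventually_elim (use N not_le in blast)
    qed
  qed
  then show ?thesis by (auto simp: topspace_omega_star)
qed

text \<open>The clopen set that Stone duality assigns to the class of \<open>A\<close> modulo finite
  sets.\<close>

definition star :: "nat set \<Rightarrow> nat filter set" where
  "star A = {u \<in> topspace omega_star. eventually (\<lambda>x. x \<in> A) u}"

lemma star_eq: "star A = stone_basic A \<inter> topspace omega_star"
  by (auto simp: star_def stone_basic_def topspace_omega_star_iff)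

lemma star_Un: "star (A \<union> B) = star A \<union> star B"
proof
  show "star (A \<union> B) \<subseteq> star A \<union> star B"
  proof
    fix u assume u: "u \<in> star (A \<union> B)"
    then have ult: "is_ultrafilter u" by (simp add: star_def topspace_omega_star_iff)
    show "u \<in> star A \<union> star B"
    proof (cases "eventually (\<lambda>x. x \<in> A) u")
      case False
      then have "eventually (\<lambda>x. x \<notin> A) u" by (rule is_ultrafilterD[OF ult])
      moreover have "eventually (\<lambda>x. x \<in> A \<union> B) u" using u by (simp add: star_def)
      ultimately have "eventually (\<lambda>x. x \<in> B) u" by eventually_elim auto
      with u show ?thesis by (simp add: star_def)
    qed (use u in \<open>simp add: star_def\<close>)
  qed
qed (auto simp: star_def elim: eventually_mono)

lemma star_Int: "star (A \<inter> B) = star A \<inter> star B"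
  by (auto simp: star_def eventually_conj_iff)

lemma star_finite: "finite A \<Longrightarrow> star A = {}"
proof -
  assume "finite A"
  then have "eventually (\<lambda>x. x \<notin> A) sequentially"
    by (simp add: cofinite_eq_sequentially[symmetric] eventually_cofinite)
  then show ?thesis
    unfolding star_def topspace_omega_star_iff
    using is_ultrafilter_contradiction filter_leD by blast
qed

lemma openin_star: "openin omega_star (star A)"
proof -
  have "openin beta_omega (stone_basic A)"
    unfolding beta_omega_def by (rule topology_generated_by_Basis) simp
  moreover have "star A = stone_basic A \<inter> - range (\<lambda>n. principal {n})"
    by (auto simp: star_eq stone_basic_def topspace_omega_star)
  ultimately show ?thesis
    unfolding omega_star_def openin_subtopology by blast
qed

text \<open>The generating sets \<open>stone_basic A\<close> are closed under finite intersections,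
  so this subbase is already a base.\<close>

lemma star_base:
  assumes "openin omega_star T" "u \<in> T"
  shows "\<exists>A. u \<in> star A \<and> star A \<subseteq> T"
proof -
  obtain S where S: "openin beta_omega S" "T = S \<inter> - range (\<lambda>n. principal {n})"
    using assms(1) unfolding omega_star_def openin_subtopology by blast
  have ult: "is_ultrafilter u"
    using openin_subset[OF assms(1)] assms(2) by (auto simp: topspace_omega_star)
  have "generate_topology_on (range stone_basic) S"
    using S(1) unfolding beta_omega_def openin_topology_generated_by_iff .
  moreover have "u \<in> S" using assms(2) S(2) by blast
  ultimately have "\<exists>A. u \<in> stone_basic A \<and> stone_basic A \<subseteq> S"
  proof (induction rule: generate_topology_on.induct)
    case (Int S T)
    then obtain A B where "u \<in> stone_basic A" "stone_basic A \<subseteq> S" "u \<in> stone_basic B" "stone_basic B \<subseteq> T"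
      by auto
    moreover have "stone_basic (A \<inter> B) = stone_basic A \<inter> stone_basic B"
      by (auto simp: stone_basic_def eventually_conj_iff)
    ultimately show ?case by (intro exI[of _ "A \<inter> B"]) auto
  next
    case (UN K)
    then show ?case by (meson Union_iff Union_upper order_trans)
  qed auto
  then obtain A where A: "u \<in> stone_basic A" "stone_basic A \<subseteq> S" by blast
  have "u \<in> topspace omega_star"
    using openin_subset[OF assms(1)] assms(2) by blast
  then show ?thesis
    using A S(2) by (intro exI[of _ A]) (auto simp: star_eq topspace_omega_star)
qed

section \<open>Radon measures on the remainder\<close>

lemma radon_probability_openin_sets:
  "radon_probability X M \<Longrightarrow> openin X U \<Longrightarrow> U \<in> sets M"
  by (simp add: radon_probability_def)

text \<open>\<open>star\<close> preserves unions and disjointness, so the measure pulls back to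
  subsets of \<omega>, where the double count works.\<close>

lemma finitely_additive_star:
  assumes M: "radon_probability omega_star M"
  shows "finitely_additive (\<lambda>A. measure M (star A))"
  unfolding finitely_additive_def
proof (intro conjI allI impI)
  interpret prob_space M using M by (simp add: radon_probability_def)
  fix A B :: "nat set" assume "A \<inter> B = {}"
  then have "star A \<inter> star B = {}"
    using star_Int[of A B] star_finite by simp
  then show "measure M (star (A \<union> B)) = measure M (star A) + measure M (star B)"
    unfolding star_Un
    by (intro finite_measure_Union radon_probability_openin_sets[OF M] openin_star)
qed simp

text \<open>The point is null, so inner regularity gives a compact set missing it with mass above
  \<open>1 - e\<close>. Its complement is an open neighbourhood and contains a basic one.\<close>

lemma non_atomic_small_star:
  assumes M: "radon_probability omega_star M" "non_atomic omega_star M"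
    and u: "u \<in> topspace omega_star" and e: "e > 0"
  shows "\<exists>A. eventually (\<lambda>x. x \<in> A) u \<and> measure M (star A) < e"
proof -
  interpret prob_space M using M by (simp add: radon_probability_def)
  have space: "space M = topspace omega_star" using M by (simp add: radon_probability_def)
  have "closedin omega_star {u}"
    using u Hausdorff_omega_star by (simp add: Hausdorff_imp_t1_space closedin_t1_singleton)
  then have "topspace omega_star - {u} \<in> sets M"
    by (intro radon_probability_openin_sets[OF M(1)] openin_diff) auto
  then have sets: "space M - {u} \<in> sets M" by (simp add: space)
  then have "space M - (space M - {u}) \<in> sets M" by blast
  moreover have "space M - (space M - {u}) = {u}" using u by (auto simp: space)
  ultimately have "{u} \<in> sets M" by simp
  then have "measure M (space M - {u}) = 1"
    using prob_compl[of "{u}"] M(2) u by (simp add: non_atomic_def)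
  \<comment> \<open>For \<open>e > 1\<close> the left side is \<open>0\<close>, because
    \<open>ennreal\<close> truncates negative numbers.\<close>
  then have "ennreal (1 - e) < emeasure M (space M - {u})"
    using e by (simp add: emeasure_eq_measure)
  also have "\<dots> = (SUP K\<in>{K. compactin omega_star K \<and> K \<in> sets M \<and> K \<subseteq> space M - {u}}. emeasure M K)"
    using M(1) sets by (simp add: radon_probability_def)
  finally obtain K where K: "compactin omega_star K" "K \<in> sets M" "K \<subseteq> space M - {u}"
    "ennreal (1 - e) < emeasure M K"
    by (auto simp: less_SUP_iff)
  have "closedin omega_star K"
    using K(1) Hausdorff_omega_star by (rule compactin_imp_closedin[rotated])
  then have "openin omega_star (topspace omega_star - K)" by (simp add: openin_diff)
  then obtain A where A: "u \<in> star A" "star A \<subseteq> topspace omega_star - K"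
    using star_base[of "topspace omega_star - K" u] u K(3) by blast
  have "measure M (star A) \<le> measure M (space M - K)"
    using A(2) sets.compl_sets[OF K(2)] by (intro finite_measure_mono) (simp_all add: space)
  also have "\<dots> = 1 - measure M K"
    using K(2) by (rule prob_compl)
  also have "\<dots> < e"
    using K(4) ennreal_leI[of "measure M K" "1 - e"] by (force simp: emeasure_eq_measure)
  finally show ?thesis using A(1) by (auto simp: star_def)
qed

text \<open>The complement of \<open>star A\<close> is a closed set of full mass that omits
  \<open>u\<close>.\<close>

lemma not_in_support_of_null_star:
  assumes M: "radon_probability omega_star M" and A: "u \<in> star A" "measure M (star A) = 0"
  shows "u \<notin> measure_support omega_star M"
proof -
  interpret prob_space M using M by (simp add: radon_probability_def)
  have space: "space M = topspace omega_star" using M by (simp add: radon_probability_def)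
  have "closedin omega_star (topspace omega_star - star A)"
    using openin_star by blast
  moreover have "measure M (topspace omega_star - star A) = 1"
    using prob_compl[OF radon_probability_openin_sets[OF M openin_star]] A(2) by (simp add: space)
  ultimately show ?thesis
    using A(1) by (auto simp: measure_support_def)
qed

section \<open>The column copies and their limit\<close>

lemma column_filter_in_omega_star:
  assumes "p \<in> topspace omega_star"
  shows "column_filter p n \<in> topspace omega_star"
  unfolding topspace_omega_star_iff
proof
  have p: "is_ultrafilter p" "p \<le> sequentially"
    using assms by (simp_all add: topspace_omega_star_iff)
  show "is_ultrafilter (column_filter p n)"
    using p(1) by (auto simp: is_ultrafilter_def trivial_limit_def eventually_column_filter)
  have "filterlim (\<lambda>j. prod_encode (n, j)) sequentially sequentially"
    by (rule filterlim_at_top_mono[OF filterlim_ident]) (simp add: le_prod_encode_2)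
  then show "column_filter p n \<le> sequentially"
    using p(2) unfolding column_filter_def filterlim_def by (meson filtermap_mono order_trans)
qed

text \<open>A predicate is decided first on each column and then, by \<open>p\<close>, on the set of
  columns where it holds.\<close>

lemma fubini_square_in_omega_star:
  assumes "p \<in> topspace omega_star"
  shows "fubini_square p \<in> topspace omega_star"
  unfolding topspace_omega_star_iff
proof
  have p: "is_ultrafilter p" "p \<le> sequentially"
    and col: "is_ultrafilter (column_filter p n)" "column_filter p n \<le> sequentially" for n
    using assms column_filter_in_omega_star[OF assms] by (simp_all add: topspace_omega_star_iff)
  show "is_ultrafilter (fubini_square p)"
    unfolding is_ultrafilter_def trivial_limit_def eventually_fubini_square
  proof (intro conjI allI)
    have "\<not> eventually (\<lambda>x. False) (column_filter p n)" "p \<noteq> bot" for n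
      using col(1)[of n] p(1) by (auto simp: is_ultrafilter_def trivial_limit_def)
    then show "\<not> eventually (\<lambda>n. eventually (\<lambda>x. False) (column_filter p n)) p"
      by (simp add: trivial_limit_def)
    show "eventually (\<lambda>n. eventually P (column_filter p n)) p \<or>
        eventually (\<lambda>n. eventually (\<lambda>x. \<not> P x) (column_filter p n)) p" for P
    proof (rule disjCI)
      assume "\<not> eventually (\<lambda>n. eventually (\<lambda>x. \<not> P x) (column_filter p n)) p"
      then have "eventually (\<lambda>n. \<not> eventually (\<lambda>x. \<not> P x) (column_filter p n)) p"
        by (rule is_ultrafilterD[OF p(1)])
      then show "eventually (\<lambda>n. eventually P (column_filter p n)) p"
        by eventually_elim (use is_ultrafilterD[OF col(1)] in force)
    qed
  qed
  show "fubini_square p \<le> sequentially"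
    using filter_leD[OF col(2)] by (intro filter_leI) (simp add: eventually_fubini_square)
qed

text \<open>The first coordinate is constantly \<open>n\<close> on the column but exceeds
  \<open>n\<close> on a member of the square.\<close>

lemma fubini_square_neq_column_filter:
  assumes "p \<in> topspace omega_star"
  shows "fubini_square p \<noteq> column_filter p n"
proof
  assume eq: "fubini_square p = column_filter p n"
  have p: "is_ultrafilter p" "p \<le> sequentially"
    using assms by (simp_all add: topspace_omega_star_iff)
  define P where "P x \<longleftrightarrow> fst (prod_decode x) = n" for x
  have "eventually P (column_filter p n)"
    by (simp add: P_def eventually_column_filter)
  then have "eventually (\<lambda>k. eventually P (column_filter p k)) p"
    unfolding eq[symmetric] eventually_fubini_square .
  then have "eventually (\<lambda>k. eventually (\<lambda>j. k = n) p) p"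
    by (simp add: P_def eventually_column_filter)
  moreover have "eventually (\<lambda>k. k > n) p"
    using filter_leD[OF p(2) eventually_gt_at_top] .
  ultimately have "eventually (\<lambda>k. eventually (\<lambda>j. False) p) p"
    by eventually_elim simp
  then show False using p(1) by (simp add: is_ultrafilter_def trivial_limit_def)
qed

theorem theorem5p8:
  "\<exists>p \<in> topspace omega_star. mu_point omega_star p \<and> \<not> weak_P_point omega_star p"
proof -
  obtain p and J :: "nat set set \<Rightarrow> nat"
    where p: "is_ultrafilter p" "p \<le> sequentially" "uniformly_OK J p"
    by (rule ex_uniformly_OK_ultrafilter)
  have p_in: "p \<in> topspace omega_star" using p by (simp add: topspace_omega_star_iff)
  define q where "q = fubini_square p"
  have q: "q \<in> topspace omega_star"
    unfolding q_def by (rule fubini_square_in_omega_star[OF p_in])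
  have "q \<notin> measure_support omega_star M"
    if M: "radon_probability omega_star M" "non_atomic omega_star M" for M
  proof -
    \<comment> \<open>Non-atomicity is used at \<open>q\<close> and at each column filter: all of
      them have members of arbitrarily small mass.\<close>
    have "\<exists>X. eventually (\<lambda>x. x \<in> X) q \<and> measure M (star X) = 0"
      unfolding q_def
    proof (rule fubini_square_null[OF uncountable_UNIV_nat_set_set p(3,2) finitely_additive_star[OF M(1)]])
      show "measure M (star X) = 0" if "finite X" for X
        using that by (simp add: star_finite)
    qed (use non_atomic_small_star[OF M] column_filter_in_omega_star[OF p_in] q q_def in auto)
    then show ?thesis
      using not_in_support_of_null_star[OF M(1)] q by (auto simp: star_def)
  qed
  then have "mu_point omega_star q"
    using q by (simp add: mu_point_def)
  moreover have "\<not> weak_P_point omega_star q"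
  proof -
    \<comment> \<open>A basic neighbourhood \<open>star A\<close> of \<open>q\<close> has
      \<open>A\<close> in \<open>p\<close>-almost all column filters, hence contains at least one of
      these countably many points.\<close>
    have "q \<in> omega_star closure_of range (column_filter p)"
      unfolding in_closure_of
    proof (intro conjI allI impI, rule q)
      fix T assume "q \<in> T \<and> openin omega_star T"
      then obtain A where A: "q \<in> star A" "star A \<subseteq> T" using star_base by blast
      then have "eventually (\<lambda>n. eventually (\<lambda>x. x \<in> A) (column_filter p n)) p"
        by (simp add: star_def q_def eventually_fubini_square)
      moreover have "p \<noteq> bot" using p(1) by (simp add: is_ultrafilter_def)
      ultimately obtain n where "eventually (\<lambda>x. x \<in> A) (column_filter p n)"
        using eventually_happens' by blast
      then show "\<exists>y. y \<in> range (column_filter p) \<and> y \<in> T"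
        using A(2) column_filter_in_omega_star[OF p_in] by (auto simp: star_def)
    qed
    moreover have "range (column_filter p) \<subseteq> topspace omega_star - {q}"
      using column_filter_in_omega_star[OF p_in] fubini_square_neq_column_filter[OF p_in, symmetric]
      by (auto simp: q_def)
    moreover have "countable (range (column_filter p))" by simp
    ultimately show ?thesis
      unfolding weak_P_point_def by meson
  qed
  ultimately show ?thesis using q by blast
qed

end
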